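(* There is an infinite word $\mathbf{w}$ over the binary alphabet $\{0,1\}$ such that $\mathbf{w}$ is $3^+$-free and its curling-number transform $C(\mathbf{w})$ is overlap-free.
   Context: Words are indexed from $0$; infinite words are one-sided, $\mathbf{w} = \mathbf{w}[0]\mathbf{w}[1]\cdots$; $x[i..j]$ denotes the factor (contiguous block) $x[i]\cdots x[j]$. A finite word $x$ of length $n \ge 1$ has period $p$, $1\le p\le n$, if $x[i]=x[i+p]$ for all $0\le i<n-p$; its exponent is $n/p$ where $p$ is its least period. A finite or infinite word is $\alpha^+$-free if it has no nonempty finite factor of exponent strictly greater than $\alpha$. An overlap is a word of the form $a x a x a$ with $a$ a single letter and $x$ a possibly empty word; a word is overlap-free if it contains no overlap as a factor (equivalently, it is $2^+$-free). The curling number of a nonempty finite word $u$ is the largest integer $k \ge 1$ such that $u = y z^k$ for some (possibly empty) word $y$ and some nonempty word $z$. For a finite or infinite word $x$, the curling-number transform $C(x)$ is the word over the positive integers, of the same length as $x$, whose $i$-th letter $C(x)[i]$ is the curling number of the prefix $x[0..i]$. *)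

theory Defs
  imports Complex_Main "HOL-Library.Omega_Words_Fun"
begin

definition has_period :: "'a list \<Rightarrow> nat \<Rightarrow> bool" where
  "has_period x p \<longleftrightarrow>
     1 \<le> p \<and> p \<le> length x \<and> (\<forall>i < length x - p. x ! i = x ! (i + p))"

definition least_period :: "'a list \<Rightarrow> nat" where
  "least_period x = (LEAST p. has_period x p)"

text \<open>Meaningful for nonempty words only: the empty word has no period.\<close>
definition exponent :: "'a list \<Rightarrow> real" where
  "exponent x = real (length x) / real (least_period x)"

text \<open>The finite factors of an infinite word \<open>w\<close> are the lists \<open>w [i \<rightarrow> j]\<close>,
  consisting of the letters at positions \<open>i, \<dots>, j - 1\<close>.\<close>
definition plus_free :: "real \<Rightarrow> 'a word \<Rightarrow> bool" where
  "plus_free \<alpha> w \<longleftrightarrow> (\<forall>i j. w [i \<rightarrow> j] \<noteq> [] \<longrightarrow> \<not> exponent (w [i \<rightarrow> j]) > \<alpha>)"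

definition is_overlap :: "'a list \<Rightarrow> bool" where
  "is_overlap u \<longleftrightarrow> (\<exists>a x. u = [a] @ x @ [a] @ x @ [a])"

definition overlap_free :: "'a word \<Rightarrow> bool" where
  "overlap_free w \<longleftrightarrow> (\<forall>i j. \<not> is_overlap (w [i \<rightarrow> j]))"

text \<open>For nonempty \<open>u\<close> the set below contains \<open>1\<close> and is bounded by \<open>length u\<close>,
  so \<open>Max\<close> is the genuine maximum.\<close>
definition curling_number :: "'a list \<Rightarrow> nat" where
  "curling_number u =
     Max {k. 1 \<le> k \<and> (\<exists>y z. z \<noteq> [] \<and> u = y @ concat (replicate k z))}"

definition curling_transform :: "'a word \<Rightarrow> nat word" where
  "curling_transform w = (\<lambda>i. curling_number (w [0 \<rightarrow> Suc i]))"

end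

theory Submission
  imports Defs
begin

text \<open>The first differences of the Thue-Morse word form a squarefree word \<open>v\<close> over three letters.
  The word \<open>w\<close> is its image under a suitable 23-uniform morphism, chosen so that all squares of
  \<open>w\<close> have period at most \<open>2\<close> and no power exceeds a cube. Then each curling number depends only
  on the last six letters read, and \<open>C(w)\<close> is the image of \<open>v\<close> under another 23-uniform morphism.
  For both morphisms, a short factor determines its position modulo \<open>23\<close>. Hence a forbidden
  repetition either has a short period, and lies within two consecutive blocks, or has a period
  divisible by \<open>23\<close>, and yields a square in \<open>v\<close>.\<close>

section \<open>The Thue-Morse word and its overlap-freeness\<close>

fun thue_morse :: "nat \<Rightarrow> int" where
  "thue_morse n = (if n = 0 then 0 else if even n then thue_morse (n div 2)
     else 1 - thue_morse (n div 2))"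

declare thue_morse.simps [simp del]

lemma thue_morse_double: "thue_morse (2 * n) = thue_morse n"
  by (cases "n = 0") (simp_all add: thue_morse.simps[of "2 * n"])

lemma thue_morse_Suc_double: "thue_morse (Suc (2 * n)) = 1 - thue_morse n"
  by (simp add: thue_morse.simps[of "Suc (2 * n)"])

lemma thue_morse_cases: "thue_morse n = 0 \<or> thue_morse n = 1"
proof (induction n rule: thue_morse.induct)
  case (1 n)
  then show ?case using thue_morse.simps[of n] by (auto split: if_splits)
qed

lemma thue_morse_even_neq: "even n \<Longrightarrow> thue_morse n \<noteq> thue_morse (n + 1)"
  using thue_morse_cases[of "n div 2"] thue_morse_double[of "n div 2"]
    thue_morse_Suc_double[of "n div 2"] by auto

lemma thue_morse_no_cube:
  "\<not> (thue_morse n = thue_morse (n + 1) \<and> thue_morse (n + 1) = thue_morse (n + 2))"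
proof -
  have "even n \<or> even (n + 1)" "n + 1 + 1 = n + 2" by simp_all
  then show ?thesis using thue_morse_even_neq by metis
qed

text \<open>The letters at \<open>2 * n + 1\<close> and \<open>2 * n + 2\<close> are
  \<open>1 - thue_morse n\<close> and \<open>thue_morse (n + 1)\<close>, so they differ only if the
  letters at \<open>n\<close> and \<open>n + 1\<close> agree. Five alternating letters contain two
  consecutive pairs of this kind, which would force three equal letters in a row.\<close>

lemma thue_morse_not_alternating:
  "\<exists>k<4. thue_morse (s + k) = thue_morse (s + k + 1)"
proof (rule ccontr)
  assume "\<not> ?thesis"
  then have alt: "thue_morse (s + k) \<noteq> thue_morse (s + k + 1)" if "k < 4" for k
    using that by blast
  define n where "n = s div 2"
  \<comment> \<open>The shift \<open>e\<close> moves \<open>s\<close> to the first odd position not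
    before it.\<close>
  define e where "e = (if even s then 1 else 0 :: nat)"
  have s: "s + e = 2 * n + 1" by (auto simp: n_def e_def elim: oddE)
  have "e + 2 < 4" by (simp add: e_def)
  moreover have "s + (e + 2) = s + e + 2" by simp
  ultimately have neq: "thue_morse (2 * n + 1) \<noteq> thue_morse (2 * n + 1 + 1)"
    "thue_morse (2 * n + 1 + 2) \<noteq> thue_morse (2 * n + 1 + 2 + 1)"
    using alt[of e] alt[of "e + 2"] unfolding s[symmetric] by simp_all
  have "1 - thue_morse n \<noteq> thue_morse (n + 1)"
    using neq(1) thue_morse_Suc_double[of n] thue_morse_double[of "n + 1"] by simp
  moreover have "1 - thue_morse (n + 1) \<noteq> thue_morse (n + 2)"
    using neq(2) thue_morse_Suc_double[of "n + 1"] thue_morse_double[of "n + 2"] by simp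
  ultimately have "thue_morse n = thue_morse (n + 1) \<and> thue_morse (n + 1) = thue_morse (n + 2)"
    using thue_morse_cases[of n] thue_morse_cases[of "n + 1"] thue_morse_cases[of "n + 2"] by auto
  then show False using thue_morse_no_cube by blast
qed

text \<open>An overlap of even period descends to one of half the period. One of odd period at least
  three alternates throughout, because the letters at positions \<open>2j\<close> and \<open>2j + 1\<close> always differ.\<close>
lemma thue_morse_overlap_free:
  assumes "0 < p"
  shows "\<exists>k\<le>p. thue_morse (s + k) \<noteq> thue_morse (s + k + p)"
  using assms
proof (induction p arbitrary: s rule: less_induct)
  case (less p)
  show ?case
  proof (rule ccontr)
    assume "\<not> ?case"
    then have eq: "thue_morse (s + k) = thue_morse (s + k + p)" if "k \<le> p" for k
      using that by blast
    show False
    proof (cases "even p")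
      case True
      then obtain q where p: "p = 2 * q" by blast
      then have "0 < q" "q < p" using less.prems by auto
      then obtain j where j: "j \<le> q"
        "thue_morse (s div 2 + j) \<noteq> thue_morse (s div 2 + j + q)"
        using less.IH by blast
      \<comment> \<open>Even offsets keep the parity of \<open>s\<close>, so halving both positions
        turns this into an equality at distance \<open>q\<close>.\<close>
      have "thue_morse (s + 2 * j) = thue_morse (s + 2 * j + p)"
        using eq[of "2 * j"] j(1) p by simp
      moreover have "s + 2 * j = 2 * (s div 2 + j) \<and> s + 2 * j + p = 2 * (s div 2 + j + q) \<or>
        s + 2 * j = Suc (2 * (s div 2 + j)) \<and> s + 2 * j + p = Suc (2 * (s div 2 + j + q))"
        using p by presburger
      ultimately show False
        using j(2) by (metis thue_morse_double thue_morse_Suc_double diff_left_imp_eq)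
    next
      case odd: False
      show False
      proof (cases "p = 1")
        case True
        then show False using eq[of 0] eq[of 1] thue_morse_no_cube[of s] by simp
      next
        case False
        then have p3: "3 \<le> p" using odd less.prems by presburger
        have alt: "thue_morse (s + k) \<noteq> thue_morse (s + k + 1)" if "k < p" for k
        proof (cases "even (s + k)")
          case False
          \<comment> \<open>The pair shifted by the odd \<open>p\<close> starts at an even position,
            so its letters differ; the period carries this back.\<close>
          then have "even (s + k + p)" using odd by simp
          then show ?thesis
            using thue_morse_even_neq[of "s + k + p"] eq[of k] eq[of "k + 1"] that
            by (simp add: ac_simps)
        qed (rule thue_morse_even_neq)
        \<comment> \<open>Only \<open>p = 3\<close>, \<open>k = 3\<close> is not covered by
          \<open>alt\<close>; that pair is the first pair shifted by the period.\<close>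
        have "thue_morse (s + k) \<noteq> thue_morse (s + k + 1)" if "k < 4" for k
        proof (cases "k < p")
          case False
          then have k: "k = p" "p = 3" using that p3 by auto
          have "thue_morse s = thue_morse (s + p)" "thue_morse (s + 1) = thue_morse (s + p + 1)"
            using eq[of 0] eq[of 1] p3 by (simp_all add: ac_simps)
          then show ?thesis using alt[of 0] k p3 by simp
        qed (rule alt)
        then show False using thue_morse_not_alternating by blast
      qed
    qed
  qed
qed

section \<open>A squarefree ternary word\<close>

definition squarefree_word :: "'a word \<Rightarrow> bool" where
  "squarefree_word v \<longleftrightarrow> (\<forall>i q. 0 < q \<longrightarrow> (\<exists>k<q. v (i + k) \<noteq> v (i + k + q)))"

definition thue_ternary :: "nat \<Rightarrow> int" where
  "thue_ternary n = thue_morse (n + 1) - thue_morse n"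

lemma thue_ternary_range: "thue_ternary n \<in> {- 1, 0, 1}"
  using thue_morse_cases[of n] thue_morse_cases[of "n + 1"] by (auto simp: thue_ternary_def)

text \<open>Summing the differences over a square shows that the Thue-Morse letters at
  \<open>i\<close>, \<open>i + q\<close> and \<open>i + 2 * q\<close> are in arithmetic progression.
  In {0, 1} such a progression is constant, so the two halves agree without offset and form an
  overlap of period \<open>q\<close>.\<close>

lemma squarefree_thue_ternary: "squarefree_word thue_ternary"
  unfolding squarefree_word_def
proof (intro allI impI, rule ccontr)
  fix i q :: nat
  assume q: "0 < q" and "\<not> (\<exists>k<q. thue_ternary (i + k) \<noteq> thue_ternary (i + k + q))"
  then have eq: "thue_ternary (i + k) = thue_ternary (i + k + q)" if "k < q" for k
    using that by blast
  have diff: "thue_morse (i + k) - thue_morse i = thue_morse (i + k + q) - thue_morse (i + q)"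
    if "k \<le> q" for k
    using that
  proof (induction k)
    case (Suc k)
    then show ?case using eq[of k] by (simp add: thue_ternary_def)
  qed simp
  have "thue_morse i = thue_morse (i + q)"
    using diff[of q] thue_morse_cases[of i] thue_morse_cases[of "i + q"]
      thue_morse_cases[of "i + q + q"] by auto
  then have "thue_morse (i + k) = thue_morse (i + k + q)" if "k \<le> q" for k
    using diff[OF that] by simp
  then show False using thue_morse_overlap_free[OF q] by blast
qed

section \<open>Uniform morphic images: synchronization and avoidance of repetitions\<close>

definition uniform_image :: "('a \<Rightarrow> 'b list) \<Rightarrow> nat \<Rightarrow> 'a word \<Rightarrow> 'b word" where
  "uniform_image h m v n = h (v (n div m)) ! (n mod m)"

lemma uniform_image_nth:
  assumes "r < m"
  shows "uniform_image h m v (m * t + r) = h (v t) ! r"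
  using assms by (simp add: uniform_image_def)

lemma uniform_image_two_blocks:
  assumes "\<And>t. length (h (v t)) = m" "r < 2 * m"
  shows "uniform_image h m v (m * t + r) = (h (v t) @ h (v (Suc t))) ! r"
proof (cases "r < m")
  case True
  then show ?thesis by (simp add: uniform_image_nth nth_append assms(1))
next
  case False
  then have "m * t + r = m * Suc t + (r - m)" "r - m < m" using assms(2) by auto
  then show ?thesis using False by (simp only: uniform_image_nth) (simp add: nth_append assms(1))
qed

text \<open>Every factor of length \<open>m\<close> of the image of a squarefree word is a prefix of
  one of these lists, whose label is its position modulo \<open>m\<close>. Adjacent letters of a
  squarefree word differ, hence \<open>a \<noteq> b\<close>.\<close>

definition two_block_suffixes :: "('a \<Rightarrow> 'b list) \<Rightarrow> 'a list \<Rightarrow> nat \<Rightarrow> (nat \<times> 'b list) list" where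
  "two_block_suffixes h as m =
     [(i, drop i (h a @ h b)). a \<leftarrow> as, b \<leftarrow> as, a \<noteq> b, i \<leftarrow> [0..<m]]"

text \<open>Says that the first \<open>n\<close> letters of a word determine its label. The recursion splits on the
  first letter, as in a trie, to avoid comparing all pairs of words.\<close>
fun separated :: "nat \<Rightarrow> ('i \<times> 'b list) list \<Rightarrow> bool" where
  "separated n [] \<longleftrightarrow> True"
| "separated 0 (x # xs) \<longleftrightarrow> list_all (\<lambda>y. fst y = fst x) xs"
| "separated (Suc n) (x # xs) \<longleftrightarrow>
     separated n (map (\<lambda>y. (fst y, tl (snd y))) (x # filter (\<lambda>y. hd (snd y) = hd (snd x)) xs)) \<and>
     separated (Suc n) (filter (\<lambda>y. hd (snd y) \<noteq> hd (snd x)) xs)"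

lemma separatedD:
  assumes "separated n xs" "(i, x) \<in> set xs" "(j, y) \<in> set xs"
    and "n \<le> length x" "n \<le> length y" "\<And>k. k < n \<Longrightarrow> x ! k = y ! k"
  shows "i = j"
  using assms
proof (induction n xs arbitrary: x y rule: separated.induct)
  case (2 z zs)
  then have "\<forall>y\<in>set (z # zs). fst y = fst z" by (simp add: list_all_iff)
  then show ?case using 2(2,3) by (metis fst_conv)
next
  case (3 n z zs)
  obtain a x' where x: "x = a # x'" using 3(6) by (cases x) auto
  obtain b y' where y: "y = b # y'" using 3(7) by (cases y) auto
  have ab: "a = b" using 3(8)[of 0] x y by simp
  show ?case
  proof (cases "a = hd (snd z)")
    case True
    let ?zs = "map (\<lambda>y. (fst y, tl (snd y))) (z # filter (\<lambda>y. hd (snd y) = hd (snd z)) zs)"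
    have step: "(l, w') \<in> set ?zs" if "(l, a # w') \<in> set (z # zs)" for l w'
    proof -
      have "(l, a # w') \<in> set (z # filter (\<lambda>y. hd (snd y) = hd (snd z)) zs)"
        using that True by auto
      then show ?thesis unfolding set_map by (rule rev_image_eqI) simp
    qed
    have "(i, x') \<in> set ?zs" "(j, y') \<in> set ?zs"
      using step 3(4,5) x y ab by blast+
    moreover have "x' ! k = y' ! k" if "k < n" for k using 3(8)[of "Suc k"] x y that by simp
    ultimately show ?thesis using 3(1)[of x' y'] 3(3,6,7) x y by simp
  next
    case False
    then have "(i, x) \<in> set (filter (\<lambda>y. hd (snd y) \<noteq> hd (snd z)) zs)"
      "(j, y) \<in> set (filter (\<lambda>y. hd (snd y) \<noteq> hd (snd z)) zs)"
      using 3(4,5) x y ab by auto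
    then show ?thesis using 3(2)[of x y] 3(3,6,7,8) by simp
  qed
qed simp

text \<open>Here \<open>len p\<close> counts consecutive agreements at distance \<open>p\<close>:
  \<open>p\<close> of them make a square, \<open>p + 1\<close> an overlap, and
  \<open>2 * p + 1\<close> more than a cube.\<close>

definition no_short_repetition ::
    "(nat \<Rightarrow> nat) \<Rightarrow> nat \<Rightarrow> (nat \<times> 'b list) list \<Rightarrow> bool" where
  "no_short_repetition len P us \<longleftrightarrow>
     list_all (\<lambda>u. list_all (\<lambda>p. take (len p) (snd u) \<noteq> take (len p) (drop p (snd u))) [1..<P]) us"

text \<open>A square whose period is a multiple of \<open>m\<close>, starting at offset
  \<open>s\<close> of a block, compares the tails of its first and middle blocks and the heads of
  its middle and last blocks. The condition forces one of these two pairs to come from equal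
  letters. The case \<open>s = 0\<close> makes \<open>h\<close> injective on
  \<open>as\<close>.\<close>

definition square_decodable :: "('a \<Rightarrow> 'b list) \<Rightarrow> 'a list \<Rightarrow> nat \<Rightarrow> bool" where
  "square_decodable h as m \<longleftrightarrow>
     list_all (\<lambda>a. list_all (\<lambda>b. list_all (\<lambda>c. a \<noteq> b \<and> b \<noteq> c \<longrightarrow>
       list_all (\<lambda>s. drop s (h a) \<noteq> drop s (h b) \<or> take s (h b) \<noteq> take s (h c)) [0..<m]) as) as) as"

lemma square_decodableD:
  assumes "square_decodable h as m" "{a, b, c} \<subseteq> set as" "s < m"
    and "\<And>x. x \<in> set as \<Longrightarrow> length (h x) = m"
    and "\<And>r. s \<le> r \<Longrightarrow> r < m \<Longrightarrow> h a ! r = h b ! r" "\<And>r. r < s \<Longrightarrow> h b ! r = h c ! r"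
  shows "a = b \<or> b = c"
proof -
  have "drop s (h a) = drop s (h b)" "take s (h b) = take s (h c)"
    using assms(2-6) by (auto intro!: nth_equalityI)
  moreover have "s \<in> set [0..<m]" using assms(3) by simp
  ultimately show ?thesis
    using assms(1,2) unfolding square_decodable_def list_all_iff by blast
qed

lemma squarefree_word_neq: "squarefree_word v \<Longrightarrow> v t \<noteq> v (Suc t)"
  unfolding squarefree_word_def by (drule spec[of _ t], drule spec[of _ 1]) simp

text \<open>If the period is long, the synchronization property makes it a multiple of \<open>m\<close>, so the
  repetition decodes to a square in \<open>v\<close>. It need not start at a block boundary: then the first,
  middle and last of the blocks involved are only partially compared.\<close>
theorem uniform_image_avoids:
  fixes h :: "'a \<Rightarrow> 'b list" and len :: "nat \<Rightarrow> nat"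
  assumes v: "squarefree_word v" "\<And>n. v n \<in> set as"
    and h: "\<And>a. a \<in> set as \<Longrightarrow> length (h a) = m"
    and sync: "separated L (two_block_suffixes h as m)" "L \<le> m"
    and short: "no_short_repetition len P (two_block_suffixes h as m)"
    and decode: "square_decodable h as m"
    and len_ge: "\<And>p. p \<le> len p" "\<And>p. P \<le> p \<Longrightarrow> L \<le> len p"
    and len_le: "\<And>p. p < P \<Longrightarrow> p + len p \<le> m"
    and m: "0 < m" and p: "0 < p"
  shows "\<exists>k<len p. uniform_image h m v (s + k) \<noteq> uniform_image h m v (s + k + p)"
proof (rule ccontr)
  let ?u = "uniform_image h m v"
  assume "\<not> ?thesis"
  then have eq: "?u (s + k) = ?u (s + k + p)" if "k < len p" for k using that by blast
  have "a \<noteq> b \<Longrightarrow> a \<in> set as \<Longrightarrow> b \<in> set as \<Longrightarrow> i < m \<Longrightarrow>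
      (i, drop i (h a @ h b)) \<in> set (two_block_suffixes h as m)" for a b i
    by (force simp: two_block_suffixes_def)
  then have mem: "i < m \<Longrightarrow> (i, drop i (h (v t) @ h (v (Suc t)))) \<in> set (two_block_suffixes h as m)"
    for i t using v squarefree_word_neq by metis
  have nth: "?u (n + k) = drop (n mod m) (h (v (n div m)) @ h (v (Suc (n div m)))) ! k"
    if "k < m" for n k
  proof -
    have r: "n mod m < m" using that by simp
    have "n + k = m * (n div m) + (n mod m + k)" by simp
    then have "?u (n + k) = (h (v (n div m)) @ h (v (Suc (n div m)))) ! (n mod m + k)"
      using uniform_image_two_blocks[of h v m "n mod m + k" "n div m"] v(2) h r that by simp
    moreover have "n mod m \<le> length (h (v (n div m)) @ h (v (Suc (n div m))))"
      using v(2) h r by simp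
    ultimately show ?thesis by (simp only: nth_drop)
  qed
  show False
  proof (cases "p < P")
    case True
    define x where "x = drop (s mod m) (h (v (s div m)) @ h (v (Suc (s div m))))"
    have "s mod m < m" using m by simp
    then have x: "m \<le> length x" using v(2) h by (simp add: x_def del: drop_append)
    have "(s mod m, x) \<in> set (two_block_suffixes h as m)" unfolding x_def using mem m by simp
    moreover have "p \<in> set [1..<P]" using p True by simp
    ultimately have "take (len p) x \<noteq> take (len p) (drop p x)"
      using short unfolding no_short_repetition_def list_all_iff by force
    moreover have "take (len p) x = take (len p) (drop p x)"
    proof (rule nth_equalityI)
      show "length (take (len p) x) = length (take (len p) (drop p x))"
        using len_le[OF True] x by simp
    next
      fix k assume "k < length (take (len p) x)"
      then have k: "k < len p" by simp
      then have "k + p < m" using len_le[OF True] by simp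
      moreover have "?u (s + (k + p)) = ?u (s + k)" using eq[OF k] by (simp add: add.assoc)
      ultimately have "x ! k = x ! (k + p)"
        using nth[of k s] nth[of "k + p" s] by (simp add: x_def del: drop_append)
      then show "take (len p) x ! k = take (len p) (drop p x) ! k"
        using k x \<open>k + p < m\<close> by (simp add: add.commute)
    qed
    ultimately show False by blast
  next
    case False
    then have L: "L \<le> len p" using len_ge by simp
    have "s mod m = (s + p) mod m"
    proof (rule separatedD[OF sync(1)])
      fix k assume "k < L"
      then have "k < m" "k < len p" using sync L by auto
      then show "drop (s mod m) (h (v (s div m)) @ h (v (Suc (s div m)))) ! k =
        drop ((s + p) mod m) (h (v ((s + p) div m)) @ h (v (Suc ((s + p) div m)))) ! k"
        using nth[of k s] nth[of k "s + p"] eq[of k] by (simp add: ac_simps)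
    next
      have "L \<le> 2 * m - i mod m" for i using mod_less_divisor[OF m, of i] sync(2) by linarith
      then show "L \<le> length (drop (s mod m) (h (v (s div m)) @ h (v (Suc (s div m)))))"
        "L \<le> length (drop ((s + p) mod m) (h (v ((s + p) div m)) @ h (v (Suc ((s + p) div m)))))"
        using v(2) h by (simp_all add: mult_2 del: drop_append)
    qed (rule mem, simp add: m)+
    then have "m dvd p" by (metis add_diff_cancel_left' dvd_minus_mod mod_eq_dvd_iff_nat le_add1)
    then obtain q where q: "p = m * q" by blast
    then have "0 < q" using p by (cases q) auto
    define t r where "t = s div m" and "r = s mod m"
    have s: "s = m * t + r" "r < m" using m by (simp_all add: t_def r_def)
    \<comment> \<open>Blocks are counted from block \<open>t\<close>, where the repetition starts;
      the bounds place the compared letter in the first period.\<close>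
    have block: "h (v (t + j)) ! i = h (v (t + j + q)) ! i"
      if "r \<le> m * j + i" "m * j + i < r + p" "i < m" for i j
    proof -
      have "m * j + i - r < len p" using that len_ge(1)[of p] by linarith
      from eq[OF this] have "?u (m * (t + j) + i) = ?u (m * (t + j + q) + i)"
        using that by (simp add: s q algebra_simps)
      then show ?thesis using that by (simp only: uniform_image_nth)
    qed
    have inner: "v (t + j) = v (t + j + q)" if "0 < j" "j < q" for j
    proof -
      have "m * 1 \<le> m * j" "m * Suc j \<le> m * q" using that by (intro mult_le_mono2; simp)+
      then have "r \<le> m * j + i" "i < m \<Longrightarrow> m * j + i < r + p" for i
        using s(2) q by (simp_all only: mult_1_right mult_Suc_right)
      then have "h (v (t + j)) ! i = h (v (t + j + q)) ! i" if "i < m" for i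
        using block that by blast
      then show ?thesis
        using square_decodableD[OF decode, of "v (t + j)" "v (t + j + q)" "v (t + j)" 0] v(2) h m
        by auto
    qed
    have "v t = v (t + q) \<or> v (t + q) = v (t + q + q)"
    proof (rule square_decodableD[OF decode _ s(2) h])
      have "m \<le> p" using \<open>0 < q\<close> q by simp
      then show "h (v t) ! i = h (v (t + q)) ! i" if "r \<le> i" "i < m" for i
        using block[of 0 i] that by simp
      show "h (v (t + q)) ! i = h (v (t + q + q)) ! i" if "i < r" for i
        using block[of q i] that s(2) \<open>m \<le> p\<close> by (simp flip: q)
    qed (use v in auto)
    \<comment> \<open>Either equality completes the inner ones to a square of period
      \<open>q\<close> in \<open>v\<close>, starting at \<open>t\<close> or at
      \<open>Suc t\<close>.\<close>
    then show False
    proof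
      assume first: "v t = v (t + q)"
      have "v (t + k) = v (t + k + q)" if "k < q" for k
        using first inner[of k] that by (cases k) auto
      then show False using v(1) \<open>0 < q\<close> unfolding squarefree_word_def by blast
    next
      assume last: "v (t + q) = v (t + q + q)"
      have "v (Suc t + k) = v (Suc t + k + q)" if "k < q" for k
        using last inner[of "Suc k"] that by (cases "Suc k = q") auto
      then show False using v(1) \<open>0 < q\<close> unfolding squarefree_word_def by blast
    qed
  qed
qed

section \<open>Curling numbers through prefix powers of reversed words\<close>

text \<open>Curling numbers concern suffixes, so this is applied to reversed words.\<close>
definition prefix_power :: "nat \<Rightarrow> nat \<Rightarrow> 'a list \<Rightarrow> bool" where
  "prefix_power k p x \<longleftrightarrow>
     k * p \<le> length x \<and> take ((k - 1) * p) x = take ((k - 1) * p) (drop p x)"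

lemma prefix_power_append:
  assumes "k * p \<le> length x"
  shows "prefix_power k p (x @ y) \<longleftrightarrow> prefix_power k p x"
proof (cases k)
  case (Suc j)
  then have "j * p \<le> length x - p" "p \<le> length x" "j * p \<le> length x" using assms by auto
  then show ?thesis using assms Suc by (simp add: prefix_power_def)
qed (simp add: prefix_power_def)

lemma prefix_power_mono:
  assumes "prefix_power (Suc k) p x"
  shows "prefix_power k p x"
proof (cases k)
  case (Suc j)
  have "take (j * p) (take (k * p) x) = take (j * p) (take (k * p) (drop p x))"
    using assms by (simp add: prefix_power_def)
  then show ?thesis using assms Suc by (simp add: prefix_power_def min_def split: if_splits)
qed (simp add: prefix_power_def)

lemma prefix_power_decompose:
  assumes "prefix_power (Suc k) p x"
  shows "x = concat (replicate (Suc k) (take p x)) @ drop (Suc k * p) x"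
  using assms
proof (induction k arbitrary: x)
  case (Suc k)
  have len: "Suc (Suc k) * p \<le> length x" 
    and eq: "take (Suc k * p) x = take (Suc k * p) (drop p x)"
    using Suc.prems by (simp_all add: prefix_power_def)
  have "drop p (take (Suc k * p) x) = drop p (take (Suc k * p) (drop p x))" using eq by simp
  then have "prefix_power (Suc k) p (drop p x)"
    using len by (simp add: prefix_power_def drop_take)
  from Suc.IH[OF this] have IH: "drop p x =
    concat (replicate (Suc k) (take p (drop p x))) @ drop (Suc k * p) (drop p x)" .
  have "take p (take (Suc k * p) x) = take p (take (Suc k * p) (drop p x))" using eq by simp
  then have "take p (drop p x) = take p x" by (simp add: min_def)
  then have "drop p x = concat (replicate (Suc k) (take p x)) @ drop (Suc (Suc k) * p) x"
    using IH by (simp add: add.commute)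
  then have "take p x @ drop p x =
    concat (replicate (Suc (Suc k)) (take p x)) @ drop (Suc (Suc k) * p) x" by simp
  then show ?case by simp
qed simp

lemma prefix_power_concat_replicate:
  "prefix_power (Suc k) (length z) (concat (replicate (Suc k) z) @ y)"
proof -
  have "concat (replicate (Suc k) z) = concat (replicate k z) @ z"
    by (simp flip: replicate_append_same)
  moreover have len: "length (concat (replicate k z)) = k * length z" by (induction k) auto
  ultimately have take: "take (k * length z) (concat (replicate (Suc k) z) @ y) =
      concat (replicate k z)" by simp
  have drop: "drop (length z) (concat (replicate (Suc k) z) @ y) = concat (replicate k z) @ y"
    by simp
  have "Suc k * length z \<le> length (concat (replicate (Suc k) z) @ y)" using len by simp
  then show ?thesis
    unfolding prefix_power_def diff_Suc_1 take drop by (rule conjI) (simp add: len)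
qed

lemma ex_power_suffix_iff:
  assumes "1 \<le> k"
  shows "(\<exists>y z. z \<noteq> [] \<and> u = y @ concat (replicate k z)) \<longleftrightarrow>
    (\<exists>p\<ge>1. prefix_power k p (rev u))"
proof
  assume "\<exists>y z. z \<noteq> [] \<and> u = y @ concat (replicate k z)"
  then obtain y z where "z \<noteq> []" "u = y @ concat (replicate k z)" by blast
  then have "rev u = concat (replicate k (rev z)) @ rev y" "1 \<le> length (rev z)"
    by (simp_all add: rev_concat map_replicate Suc_le_eq)
  then show "\<exists>p\<ge>1. prefix_power k p (rev u)"
    using prefix_power_concat_replicate[of "k - 1" "rev z" "rev y"] assms by auto
next
  assume "\<exists>p\<ge>1. prefix_power k p (rev u)"
  then obtain p where p: "1 \<le> p" "prefix_power k p (rev u)" by blast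
  define z where z: "z = take p (rev u)"
  have y: "rev u = concat (replicate k z) @ drop (k * p) (rev u)"
    using prefix_power_decompose[of "k - 1" p "rev u"] p assms unfolding z by simp
  have "p \<le> k * p" using assms by simp
  then have "p \<le> length (rev u)" using p unfolding prefix_power_def by linarith
  then have "z \<noteq> []" using z p by (auto simp flip: length_greater_0_conv)
  moreover have "u = rev (drop (k * p) (rev u)) @ concat (replicate k (rev z))"
    using arg_cong[OF y, of rev]
    by (metis rev_rev_ident rev_append rev_concat rev_replicate map_replicate)
  ultimately show "\<exists>y z. z \<noteq> [] \<and> u = y @ concat (replicate k z)"
    by (metis rev_is_Nil_conv)
qed

text \<open>An evaluable substitute for the curling number of the reversed word, valid when no
  suffix of that word is a fourth power or a square of period at least 3.\<close>

definition short_curl :: "'a list \<Rightarrow> nat" where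
  "short_curl x = (if prefix_power 3 1 x \<or> prefix_power 3 2 x then 3
     else if prefix_power 2 1 x \<or> prefix_power 2 2 x then 2 else 1)"

text \<open>The longest power tested is a cube of period 2, of length six.\<close>

lemma short_curl_append:
  assumes "6 \<le> length x"
  shows "short_curl (x @ y) = short_curl x"
  using assms by (simp add: short_curl_def prefix_power_append)

lemma curling_number_eq_short_curl:
  assumes "u \<noteq> []"
    and no4: "\<And>p. 1 \<le> p \<Longrightarrow> \<not> prefix_power 4 p (rev u)"
    and no2: "\<And>p. 3 \<le> p \<Longrightarrow> \<not> prefix_power 2 p (rev u)"
  shows "curling_number u = short_curl (rev u)"
proof -
  let ?K = "{k. 1 \<le> k \<and> (\<exists>p\<ge>1. prefix_power k p (rev u))}"
  have mono: "prefix_power k p (rev u)" if "prefix_power l p (rev u)" "k \<le> l" for k l p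
    using that(2,1) by (induction rule: dec_induct) (auto dest: prefix_power_mono)
  have K: "{k. 1 \<le> k \<and> (\<exists>y z. z \<noteq> [] \<and> u = y @ concat (replicate k z))} = ?K"
    by (rule Collect_cong, rule conj_cong[OF refl], rule ex_power_suffix_iff)
  have one: "prefix_power 1 1 (rev u)"
    using assms(1) by (simp add: prefix_power_def Suc_le_eq)
  have le3: "k \<le> 3" if "k \<in> ?K" for k
  proof (rule ccontr)
    assume "\<not> k \<le> 3"
    then have "4 \<le> k" by simp
    then show False using that mono no4 by blast
  qed
  have p12: "prefix_power k 1 (rev u) \<or> prefix_power k 2 (rev u)" if k: "k \<in> ?K" "2 \<le> k" for k
  proof -
    obtain p where p: "1 \<le> p" "prefix_power k p (rev u)" using k(1) by auto
    have "\<not> 3 \<le> p" using mono[OF p(2) k(2)] no2[of p] by blast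
    then have "p = 1 \<or> p = 2" using p by auto
    then show ?thesis using p by auto
  qed
  have "Max ?K = short_curl (rev u)"
  proof (rule Max_eqI)
    show "finite ?K" using le3 by (meson finite_nat_set_iff_bounded_le)
    show "short_curl (rev u) \<in> ?K"
    proof -
      have "k \<in> ?K" if "prefix_power k 1 (rev u) \<or> prefix_power k 2 (rev u)" "1 \<le> k" for k
      proof -
        have "\<exists>p\<ge>1. prefix_power k p (rev u)"
          using that(1) le_refl[of "1::nat"] one_le_numeral by metis
        then show ?thesis using that(2) by simp
      qed
      then show ?thesis using one unfolding short_curl_def by simp
    qed
  next
    fix k assume k: "k \<in> ?K"
    then have "1 \<le> k" "k \<le> 3" using le3[OF k] by simp_all
    then consider "k = 1" | "k = 2" | "k = 3" by linarith
    then show "k \<le> short_curl (rev u)"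
      using p12[OF k] by cases (auto simp: short_curl_def)
  qed
  then show ?thesis unfolding curling_number_def K .
qed

text \<open>Restates a power ending a prefix of \<open>w\<close> as agreements at distance
  \<open>p\<close>, the form in which avoidance is proved.\<close>

lemma prefix_power_rev_nth:
  assumes "prefix_power (Suc k) p (rev (map w [0..<N]))" and "j < k * p"
  shows "w (N - Suc k * p + j) = w (N - Suc k * p + j + p)"
proof -
  let ?x = "rev (map w [0..<N])"
  \<comment> \<open>The mirror image of \<open>j\<close>: in the reversed word, index
    \<open>i\<close> holds the letter at \<open>N - Suc k * p + j + p\<close>.\<close>
  define i where "i = k * p - 1 - j"
  have len: "Suc k * p \<le> N" and eq: "take (k * p) ?x = take (k * p) (drop p ?x)"
    using assms(1) by (simp_all add: prefix_power_def)
  have i: "i < k * p" using assms(2) by (simp add: i_def)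
  have "take (k * p) ?x ! i = take (k * p) (drop p ?x) ! i" using eq by simp
  then have "?x ! i = ?x ! (p + i)" using i len by (simp del: drop_rev)
  then have "w (N - Suc i) = w (N - Suc (p + i))" using i len by (simp add: rev_nth)
  moreover have "N - Suc i = N - Suc k * p + j + p" "N - Suc (p + i) = N - Suc k * p + j"
    using len assms(2) by (simp_all add: i_def)
  ultimately show ?thesis by simp
qed

section \<open>The two 23-uniform morphisms and the transform of the image word\<close>

text \<open>The blocks were found by a computer search. Each block starts with \<open>0001\<close> and ends with
  \<open>001011\<close>, so the curling numbers inside a block do not depend on the preceding block,
  even if there is none.\<close>
definition block :: "int \<Rightarrow> nat list" where
  "block a =
    (if a = - 1 then [0,0,0,1,0,1,0,1,1,0,0,1,0,1,1,1,0,0,0,1,0,1,1]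
     else if a = 0 then [0,0,0,1,1,0,1,0,0,0,1,0,1,0,1,1,1,0,0,1,0,1,1]
     else [0,0,0,1,1,0,1,0,1,0,0,0,1,0,1,1,1,0,0,1,0,1,1])"

text \<open>The curling numbers along \<open>block a\<close>, confirmed by evaluation in
  \<open>short_curl_first_block\<close> and \<open>short_curl_two_blocks\<close>.\<close>

definition curl_block :: "int \<Rightarrow> nat list" where
  "curl_block a =
    (if a = - 1 then [1,2,3,1,1,2,2,3,2,1,2,1,1,2,2,3,1,2,3,1,1,2,2]
     else if a = 0 then [1,2,3,1,2,1,1,2,2,3,1,1,2,2,3,2,3,1,2,1,1,2,2]
     else [1,2,3,1,2,1,1,2,2,3,2,3,1,1,2,2,3,1,2,1,1,2,2])"

abbreviation thue_block_word :: "nat word" where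
  "thue_block_word \<equiv> uniform_image block 23 thue_ternary"

lemma thue_ternary_letters: "thue_ternary n \<in> set [- 1, 0, 1]"
  using thue_ternary_range by auto

lemma length_block: "length (block a) = 23"
  by (simp add: block_def)

lemma length_curl_block: "length (curl_block a) = 23"
  by (simp add: curl_block_def)

text \<open>The threshold permits cubes of periods 1 and 2, but nothing longer, and excludes every
  square of period at least 3.\<close>

lemma thue_block_word_avoids:
  assumes "0 < p"
  shows "\<exists>k < (if p \<le> 2 then 2 * p + 1 else p).
    thue_block_word (s + k) \<noteq> thue_block_word (s + k + p)"
proof (rule uniform_image_avoids)
  \<comment> \<open>Eleven letters fix the position modulo 23. Periods from 11 on provide that many
    agreements; for smaller periods the repetition has at most 20 letters and fits into one window
    of 23.\<close>
  show "separated 11 (two_block_suffixes block [- 1, 0, 1] 23)"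
    by code_simp
  show "no_short_repetition (\<lambda>p::nat. if p \<le> 2 then 2 * p + 1 else p) 11
      (two_block_suffixes block [- 1, 0, 1] 23)"
    by code_simp
  show "square_decodable block [- 1, 0, 1] 23"
    by code_simp
qed (simp_all add: assms squarefree_thue_ternary length_block thue_ternary_letters del: list.set)

lemma thue_curl_word_avoids:
  assumes "0 < p"
  shows "\<exists>k < p + 1. uniform_image curl_block 23 thue_ternary (s + k) \<noteq>
    uniform_image curl_block 23 thue_ternary (s + k + p)"
proof (rule uniform_image_avoids)
  \<comment> \<open>Nine letters suffice here, and an overlap of period at least 8 has nine
    agreements; for smaller periods it has at most 15 letters.\<close>
  show "separated 9 (two_block_suffixes curl_block [- 1, 0, 1] 23)"
    by code_simp
  show "no_short_repetition (\<lambda>p::nat. p + 1) 8 (two_block_suffixes curl_block [- 1, 0, 1] 23)"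
    by code_simp
  show "square_decodable curl_block [- 1, 0, 1] 23"
    by code_simp
qed (simp_all add: assms squarefree_thue_ternary length_curl_block thue_ternary_letters del: list.set)

lemma short_curl_first_block:
  "list_all (\<lambda>b. list_all (\<lambda>r. short_curl (rev (take (Suc r) (block b))) = curl_block b ! r)
     [0..<23]) [- 1, 0, 1]"
  by code_simp

lemma short_curl_two_blocks:
  "list_all (\<lambda>a. list_all (\<lambda>b. a \<noteq> b \<longrightarrow>
     list_all (\<lambda>r. short_curl (rev (take (23 + Suc r) (block a @ block b))) = curl_block b ! r)
     [0..<23]) [- 1, 0, 1]) [- 1, 0, 1]"
  by code_simp

lemma map_thue_block_word:
  "map (\<lambda>k. thue_block_word (23 * t + k)) [0..<23] = block (thue_ternary t)"
proof (rule nth_equalityI)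
  fix i assume "i < length (map (\<lambda>k. thue_block_word (23 * t + k)) [0..<23])"
  then have "i < 23" by simp
  then show "map (\<lambda>k. thue_block_word (23 * t + k)) [0..<23] ! i = block (thue_ternary t) ! i"
    by (simp add: uniform_image_nth del: upt_rec_numeral)
qed (simp add: length_block)

lemma short_curl_thue_block_word:
  "short_curl (rev (map thue_block_word [0..<Suc n])) = uniform_image curl_block 23 thue_ternary n"
proof -
  let ?w = thue_block_word and ?v = thue_ternary
  define t r where "t = n div 23" and "r = n mod 23"
  have n: "n = 23 * t + r" and r: "r < 23" by (simp_all add: t_def r_def)
  have last: "map ?w [23 * t..<Suc n] = take (Suc r) (block (?v t))"
    unfolding n using r by (intro nth_equalityI) 
      (auto simp: length_block uniform_image_nth simp del: upt_Suc)
  have goal: "uniform_image curl_block 23 ?v n = curl_block (?v t) ! r"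
    unfolding n by (rule uniform_image_nth[OF r])
  show ?thesis
  proof (cases t)
    case 0
    have "?v 0 \<in> set [- 1, 0, 1]" "r \<in> set [0..<23]" using thue_ternary_letters r by auto
    then have "short_curl (rev (take (Suc r) (block (?v 0)))) = curl_block (?v 0) ! r"
      using short_curl_first_block unfolding list_all_iff by blast
    then show ?thesis unfolding goal using last 0 by simp
  next
    case (Suc t')
    have split: "[0..<Suc n] = [0..<23 * t'] @ [23 * t'..<23 * t] @ [23 * t..<Suc n]"
    proof -
      have "[0..<23 * t + Suc r] = [0..<23 * t] @ [23 * t..<23 * t + Suc r]"
        by (rule upt_add_eq_append) simp
      also have "[0..<23 * t' + 23] = [0..<23 * t'] @ [23 * t'..<23 * t' + 23]"
        by (rule upt_add_eq_append) simp
      then have "[0..<23 * t] = [0..<23 * t'] @ [23 * t'..<23 * t]"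
        using Suc by (simp add: add.commute del: upt_Suc upt_rec_numeral)
      finally show ?thesis by (simp add: n del: upt_Suc)
    qed
    have "map ?w [23 * t'..<23 * t] = block (?v t')"
      unfolding map_thue_block_word[symmetric] Suc
      by (intro nth_equalityI) auto
    then have "map ?w [0..<Suc n] =
        map ?w [0..<23 * t'] @ take (23 + Suc r) (block (?v t') @ block (?v t))"
      unfolding split map_append last by (simp add: length_block)
    \<comment> \<open>The last two blocks contribute at least 24 letters, more than the six that
      \<open>short_curl\<close> inspects, so the earlier letters drop out.\<close>
    then have "short_curl (rev (map ?w [0..<Suc n])) =
        short_curl (rev (take (23 + Suc r) (block (?v t') @ block (?v t))))"
      by (simp add: short_curl_append length_block del: take_append)
    moreover have "?v t' \<in> set [- 1, 0, 1]" "?v t \<in> set [- 1, 0, 1]" "r \<in> set [0..<23]"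
      using thue_ternary_letters r by (blast | simp)+
    moreover have "?v t' \<noteq> ?v t"
      unfolding Suc by (rule squarefree_word_neq[OF squarefree_thue_ternary])
    ultimately show ?thesis
      unfolding goal using short_curl_two_blocks unfolding list_all_iff by metis
  qed
qed

lemma curling_transform_thue_block_word:
  "curling_transform thue_block_word = uniform_image curl_block 23 thue_ternary"
proof
  fix n
  let ?w = thue_block_word
  \<comment> \<open>A suffix power of exponent \<open>Suc k\<close> gives \<open>k * p\<close>
    agreements in a row, which must stay below the threshold. This excludes \<open>k = 3\<close> for
    all \<open>p\<close>, and \<open>k = 1\<close> for \<open>p\<close> at least 3.\<close>
  have avoid: "k * p < (if p \<le> 2 then 2 * p + 1 else p)"
    if pow: "prefix_power (Suc k) p (rev (map ?w [0..<Suc n]))" and "0 < p" for k p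
  proof (rule ccontr)
    assume long: "\<not> ?thesis"
    obtain j where j: "j < (if p \<le> 2 then 2 * p + 1 else p)"
      "?w (Suc n - Suc k * p + j) \<noteq> ?w (Suc n - Suc k * p + j + p)"
      using thue_block_word_avoids[OF \<open>0 < p\<close>] by blast
    then have "j < k * p" using long by simp
    then show False using prefix_power_rev_nth[OF pow] j(2) by blast
  qed
  have "curling_number (map ?w [0..<Suc n]) = short_curl (rev (map ?w [0..<Suc n]))"
  proof (rule curling_number_eq_short_curl)
    show "\<not> prefix_power 4 p (rev (map ?w [0..<Suc n]))" if "1 \<le> p" for p
      using avoid[of 3 p] that by (auto simp del: upt_Suc split: if_splits)
    show "\<not> prefix_power 2 p (rev (map ?w [0..<Suc n]))" if "3 \<le> p" for p
      using avoid[of 1 p] that by (auto simp del: upt_Suc simp: numeral_2_eq_2)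
  qed simp
  then show "curling_transform ?w n = uniform_image curl_block 23 thue_ternary n"
    unfolding curling_transform_def subsequence_def short_curl_thue_block_word .
qed

section \<open>From letter mismatches to the stated freeness properties\<close>

text \<open>An exponent above \<open>Suc n\<close> means a length exceeding \<open>Suc n * p\<close>
  for the least period \<open>p\<close>, hence at least \<open>n * p + 1\<close> agreements at
  distance \<open>p\<close>.\<close>

lemma plus_freeI:
  assumes "\<And>s p. 0 < p \<Longrightarrow> \<exists>k \<le> n * p. w (s + k) \<noteq> w (s + k + p)"
  shows "plus_free (real (Suc n)) w"
  unfolding plus_free_def
proof (intro allI impI notI)
  fix i j
  let ?x = "w [i \<rightarrow> j]"
  assume "?x \<noteq> []" and exp: "real (Suc n) < exponent ?x"
  \<comment> \<open>The full length is a period, so the \<open>LEAST\<close> in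
    \<open>least_period\<close> is attained.\<close>
  then have "has_period ?x (length ?x)" by (simp add: has_period_def Suc_le_eq)
  then have period: "has_period ?x (least_period ?x)"
    unfolding least_period_def by (rule LeastI)
  define p where "p = least_period ?x"
  have p: "0 < p" using period by (simp add: has_period_def p_def)
  then have "real (Suc n * p) < real (length ?x)"
    using exp by (simp add: exponent_def p_def field_simps)
  then have len: "Suc n * p < j - i" by (simp only: of_nat_less_iff) simp
  obtain k where k: "k \<le> n * p" "w (i + k) \<noteq> w (i + k + p)" using assms p by blast
  then have "k < length ?x - p" using len by simp
  then have "?x ! k = ?x ! (k + p)" using period by (simp add: has_period_def p_def)
  then show False using k len by (simp add: subsequence_def add.assoc)
qed

text \<open>An overlap with inner word \<open>x\<close> has period \<open>p = Suc (length x)\<close>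
  and length \<open>2 * p + 1\<close>, giving \<open>p + 1\<close> agreements.\<close>

lemma overlap_freeI:
  assumes "\<And>s p. 0 < p \<Longrightarrow> \<exists>k \<le> p. w (s + k) \<noteq> w (s + k + p)"
  shows "overlap_free w"
  unfolding overlap_free_def is_overlap_def
proof (intro allI notI, elim exE)
  fix i j a x
  assume eq: "w [i \<rightarrow> j] = [a] @ x @ [a] @ x @ [a]"
  define p where "p = Suc (length x)"
  obtain k where k: "k \<le> p" "w (i + k) \<noteq> w (i + k + p)" using assms[of p i] by (auto simp: p_def)
  have len: "j - i = 2 * p + 1" using arg_cong[OF eq, of length] by (simp add: p_def)
  have nth: "w (i + l) = ([a] @ x @ [a] @ x @ [a]) ! l" if "l < 2 * p + 1" for l
    unfolding eq[symmetric] using that len by (simp add: subsequence_def)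
  have "([a] @ x @ [a] @ x @ [a]) ! k = ([a] @ x @ [a] @ x @ [a]) ! (k + p)"
    using k(1) by (auto simp: p_def nth_append nth_Cons' less_Suc_eq_le)
  then show False using k nth[of k] nth[of "k + p"] by (simp add: add.assoc)
qed

theorem theorem3:
  shows "\<exists>w :: nat word. range w \<subseteq> {0, 1} \<and> plus_free 3 w \<and>
    overlap_free (curling_transform w)"
proof (intro exI conjI)
  show "range thue_block_word \<subseteq> {0, 1}"
  proof
    fix x assume "x \<in> range thue_block_word"
    then obtain n where "x = block (thue_ternary (n div 23)) ! (n mod 23)"
      by (auto simp: uniform_image_def)
    then have "x \<in> set (block (thue_ternary (n div 23)))" by (simp add: length_block)
    then show "x \<in> {0, 1}" by (auto simp: block_def split: if_splits)
  qed
  have "plus_free (real (Suc 2)) thue_block_word"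
  proof (rule plus_freeI)
    fix s p :: nat assume "0 < p"
    then obtain k where "k < (if p \<le> 2 then 2 * p + 1 else p)"
      "thue_block_word (s + k) \<noteq> thue_block_word (s + k + p)"
      using thue_block_word_avoids by blast
    then show "\<exists>k\<le>2 * p. thue_block_word (s + k) \<noteq> thue_block_word (s + k + p)"
      by (intro exI[of _ k]) (auto split: if_splits)
  qed
  then show "plus_free 3 thue_block_word" by simp
  show "overlap_free (curling_transform thue_block_word)"
    unfolding curling_transform_thue_block_word
    using thue_curl_word_avoids by (intro overlap_freeI) (simp add: less_Suc_eq_le)
qed

end
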